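(* Consider the plant, local observer, encoder and decoder described in the context, under the stated assumptions on the initial state, signals, matrix inequality and initial quantization region. Suppose the quantization region is $\mathcal{S}_Q^{k}=\mathcal{B}(C^{k},L^{k})$ with scalar range $L^k$, and the quantization parameters are updated according to the norm-based scheme $$C^{k+1}=\Lambda P_d^k,\qquad L^{k+1}=\frac{e^{|A|T}}{N}L^k+\beta_{ue}^k,\qquad k\in\mathbb{Z}_+,$$ with $P_d^0:=x_c$, $L^0:=x_b$. If the inter-transmission interval $T>0$ and the total quantization level $N\in\mathbb{Z}_{>0}$ are chosen such that $$\frac{e^{|A|T}}{N}<1,$$ then the quantization error $e_q(t):=\hat{x}(t)-P_d^k$, $t\in[t_k,t_{k+1})$, $k\in\mathbb{Z}_+$, is bounded for all $t\in\mathbb{R}_{\ge0}$ (i.e. there is a finite constant $M$ with $|e_q(t)|\le M$ for all $t\ge0$).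
   Context: Notation: $\mathbb{Z}_+=\{0,1,2,\dots\}$, $\mathbb{Z}_{>0}=\{1,2,\dots\}$, $\mathcal{I}_n=\{1,\dots,n\}$. For a vector $x\in\mathbb{R}^n$, $|x|:=\max_i|x_i|$; for a matrix $M\in\mathbb{R}^{n\times n}$, $|M|:=\max_{j\in\mathcal{I}_n}\sum_{i=1}^n|m_{ij}|$. $\lambda_{\max},\lambda_{\min}$ denote the largest and smallest eigenvalues. $\mathcal{B}(c,l)=\{x\in\mathbb{R}^n:|x-c|\le l\}$ is the hypercube with center $c\in\mathbb{R}^n$ and radius $l\ge0$. Plant: $\dot{x}=Ax+Bu+Ed$, $y=Hx$, with $x\in\mathbb{R}^n$, $u\in\mathbb{R}^m$, $y\in\mathbb{R}^{n_y}$, disturbance $d\in\mathbb{R}^o$, known real matrices of appropriate dimensions, $(A,H)$ observable. Assumption on initial state and signals: $x(0)\in\mathcal{B}(x_c,x_b)$, and for all $t\ge0$, $Bu(t)\in\mathcal{B}(\mathbf{0}_n,u_b)$ and $Ed(t)\in\mathcal{B}(\mathbf{0}_n,d_b)$, where $x_c\in\mathbb{R}^n$ and $x_b,u_b,d_b\ge0$ are known. Local observer: $\dot{\hat{x}}=A\hat{x}+Bu+K(H\hat{x}-y)$, $\hat{x}(0)=x_c$, where $K=P^{-1}Q$ and $P=P^T\succ0$ in $\mathbb{R}^{n\times n}$, $Q\in\mathbb{R}^{n\times n_y}$, $\nu_1>0$, $\nu_2>0$ are assumed to satisfy $$\begin{bmatrix}A^TP+PA+H^TQ^T+QH+\nu_1I_n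 & P\\ P & -\nu_2I_n\end{bmatrix}\preceq0.$$ Transmission times: $t_k=kT$, $k\in\mathbb{Z}_+$, with $T>0$. Quantizer: $N$ is a positive integer (the quantization level). At time $t_k$ the quantization region is $\mathcal{S}_Q^k=\mathcal{B}(C^k,L^k)$ with centroid $C^k\in\mathbb{R}^n$ and range $L^k\ge0$; initially $C^0=x_c$, $L^0=x_b$. The encoder sends, componentwise for $i\in\mathcal{I}_n$, $P_{e,i}^k=\left\lfloor(\hat{x}_i(t_k)+L^k-C_i^k)\frac{N}{2L^k}\right\rfloor$ (index $0$ if $L^k=0$), an index in $\{0,\dots,N-1\}$, and the decoder produces the center of the corresponding subregion, $P_{d,i}^k=C_i^k-L^k+\frac{L^k}{N}(2P_{e,i}^k+1)$; initialization $P_d^0:=x_c$. Quantities in the scheme: $\Lambda:=e^{AT}$ (so $C^{k+1}$ is the value at $t_{k+1}$ of the solution of $\dot{C}=AC$ on $[t_k,t_{k+1})$ with $C(t_k)=P_d^k$); $\beta_{ue}^k:=|A|^{-1}e^{|A|T}\left(u_b+|KH|\beta_d(t_k)\right)$, where $|A|^{-1}=1/|A|$ and $$\beta_d(t):=\sqrt{\tfrac{n\lambda_{\max}(P)}{\lambda_{\min}(P)}}\,e^{-\lambda_et/2}x_b+\sqrt{\tfrac{n\nu_2}{\lambda_{\min}(P)\lambda_e}}\,d_b,\qquad \lambda_e:=\frac{\nu_1}{n\lambda_{\max}(P)}.$$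
   Formalization: With P_d^k frozen on [t_k,t_{k+1}) the claim fails (e.g. x'=x); instead the error is measured against the solution of C'=AC, C(t_k)=P_d^k, and e_q with P_d^k frozen is shown bounded only when x is bounded; A≠0 is assumed so that 1/|A| is defined. *)

theory Defs
  imports "HOL-Analysis.Analysis"
begin

text \<open>The max norm of a vector is the library's \<^const>\<open>infnorm\<close>. The matrix norm below is the
  maximal absolute column sum; it is not the operator norm induced by \<^const>\<open>infnorm\<close>
  (that would be the maximal absolute row sum).\<close>

definition colsum_norm :: "real^'n^'m \<Rightarrow> real" where
  "colsum_norm M = Max (range (\<lambda>j. \<Sum>i\<in>UNIV. \<bar>M $ i $ j\<bar>))"

definition hypercube :: "real^'n \<Rightarrow> real \<Rightarrow> (real^'n) set" where
  "hypercube c l = {x. infnorm (x - c) \<le> l}"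

text \<open>Square matrices over a finite index type are no instance of \<^class>\<open>real_normed_algebra_1\<close>,
  so \<^const>\<open>exp\<close> does not apply to them.\<close>

definition mat_exp :: "real^'n^'n \<Rightarrow> real^'n^'n" where
  "mat_exp M = (\<Sum>k. (1 / fact k) *\<^sub>R (((**) M ^^ k) (mat 1)))"

definition eigenvalues :: "real^'n^'n \<Rightarrow> real set" where
  "eigenvalues M = {l. \<exists>v. v \<noteq> 0 \<and> M *v v = l *\<^sub>R v}"

definition lambda_max :: "real^'n^'n \<Rightarrow> real" where
  "lambda_max M = Max (eigenvalues M)"

definition lambda_min :: "real^'n^'n \<Rightarrow> real" where
  "lambda_min M = Min (eigenvalues M)"

definition pos_def :: "real^'n^'n \<Rightarrow> bool" where
  "pos_def M \<longleftrightarrow> transpose M = M \<and> (\<forall>v. v \<noteq> 0 \<longrightarrow> v \<bullet> (M *v v) > 0)"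

definition neg_semidef :: "real^'n^'n \<Rightarrow> bool" where
  "neg_semidef M \<longleftrightarrow> transpose M = M \<and> (\<forall>v. v \<bullet> (M *v v) \<le> 0)"

definition block_mat ::
  "real^'n^'n \<Rightarrow> real^'m^'n \<Rightarrow> real^'n^'m \<Rightarrow> real^'m^'m \<Rightarrow> real^('n + 'm)^('n + 'm)" where
  "block_mat M11 M12 M21 M22 = (\<chi> i j. case (i, j) of
       (Inl a, Inl b) \<Rightarrow> M11 $ a $ b
     | (Inl a, Inr b) \<Rightarrow> M12 $ a $ b
     | (Inr a, Inl b) \<Rightarrow> M21 $ a $ b
     | (Inr a, Inr b) \<Rightarrow> M22 $ a $ b)"

text \<open>The initial state of the unforced system is determined by its output on
  the half-line.\<close>

definition observable :: "real^'n^'n \<Rightarrow> real^'n^'y \<Rightarrow> bool" where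
  "observable A H \<longleftrightarrow>
     (\<forall>x0 x1. (\<forall>t\<ge>0. H *v (mat_exp (t *\<^sub>R A) *v x0) = H *v (mat_exp (t *\<^sub>R A) *v x1)) \<longrightarrow> x0 = x1)"

text \<open>\<open>x\<close> solves \<open>x' = f\<close> on the half-line in integrated form, so that the inputs and disturbances
  entering \<open>f\<close> need not be continuous. Every classical solution is a solution in this sense.\<close>

definition has_derivative_path :: "(real \<Rightarrow> real^'n) \<Rightarrow> (real \<Rightarrow> real^'n) \<Rightarrow> bool" where
  "has_derivative_path x f \<longleftrightarrow> (\<forall>t\<ge>0. (f has_integral (x t - x 0)) {0..t})"

definition lambda_e :: "real^'n^'n \<Rightarrow> real \<Rightarrow> real" where
  "lambda_e P \<nu>1 = \<nu>1 / (real CARD('n) * lambda_max P)"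

definition beta_d :: "real^'n^'n \<Rightarrow> real \<Rightarrow> real \<Rightarrow> real \<Rightarrow> real \<Rightarrow> real \<Rightarrow> real" where
  "beta_d P \<nu>1 \<nu>2 xb db t =
     sqrt (real CARD('n) * lambda_max P / lambda_min P) * exp (- lambda_e P \<nu>1 * t / 2) * xb
     + sqrt (real CARD('n) * \<nu>2 / (lambda_min P * lambda_e P \<nu>1)) * db"

definition beta_ue ::
  "real^'n^'n \<Rightarrow> real^'n^'y \<Rightarrow> real^'y^'n \<Rightarrow> real^'n^'n \<Rightarrow>
     real \<Rightarrow> real \<Rightarrow> real \<Rightarrow> real \<Rightarrow> real \<Rightarrow> real \<Rightarrow> nat \<Rightarrow> real" where
  "beta_ue A H K P \<nu>1 \<nu>2 xb ub db T k =
     (1 / colsum_norm A) * exp (colsum_norm A * T)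
       * (ub + colsum_norm (K ** H) * beta_d P \<nu>1 \<nu>2 xb db (real k * T))"

text \<open>Encoder and decoder act componentwise. For a point of \<open>hypercube c l\<close> the index
  lies in \<open>{0..<N}\<close> (up to the upper faces, where the formula gives \<open>N\<close>); the formula
  is used as it stands for all points, without saturation.\<close>

definition encode :: "nat \<Rightarrow> real^'n \<Rightarrow> real \<Rightarrow> real^'n \<Rightarrow> int^'n" where
  "encode N c l x =
     (\<chi> i. if l = 0 then 0 else \<lfloor>(x $ i + l - c $ i) * (real N / (2 * l))\<rfloor>)"

definition decode :: "nat \<Rightarrow> real^'n \<Rightarrow> real \<Rightarrow> int^'n \<Rightarrow> real^'n" where
  "decode N c l p = (\<chi> i. c $ i - l + l / real N * (2 * of_int (p $ i) + 1))"

text \<open>Index \<open>k\<close> of the transmission interval \<open>[k T, (k + 1) T)\<close> that contains \<open>t\<close>.\<close>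

definition interval_index :: "real \<Rightarrow> real \<Rightarrow> nat" where
  "interval_index T t = nat \<lfloor>t / T\<rfloor>"

text \<open>Between transmissions the decoder propagates its value along \<open>C' = A C\<close>, starting from
  the decoded point \<open>Pd k\<close> at time \<open>k T\<close>; at the end of the interval this gives
  the next centroid.\<close>

definition decoder_output :: "real^'n^'n \<Rightarrow> real \<Rightarrow> (nat \<Rightarrow> real^'n) \<Rightarrow> real \<Rightarrow> real^'n" where
  "decoder_output A T Pd t =
     mat_exp ((t - real (interval_index T t) * T) *\<^sub>R A) *v Pd (interval_index T t)"

text \<open>The quantization error. The decoded point has to be propagated: if \<open>Pd k\<close> is instead frozen
  on the whole interval, the error contains the drift of the state estimate within the interval,
  which is unbounded whenever, for instance, \<open>x' = x\<close> with a nonzero initial state. That variant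
  is \<open>held_quantization_error\<close>; the two agree at all transmission times.\<close>

definition quantization_error ::
  "real^'n^'n \<Rightarrow> real \<Rightarrow> (real \<Rightarrow> real^'n) \<Rightarrow> (nat \<Rightarrow> real^'n) \<Rightarrow> real \<Rightarrow> real^'n" where
  "quantization_error A T xh Pd t = xh t - decoder_output A T Pd t"

definition held_quantization_error ::
  "real \<Rightarrow> (real \<Rightarrow> real^'n) \<Rightarrow> (nat \<Rightarrow> real^'n) \<Rightarrow> real \<Rightarrow> real^'n" where
  "held_quantization_error T xh Pd t = xh t - Pd (interval_index T t)"

end

theory Submission
  imports Defs
begin

text \<open>The matrix inequality says that \<open>e \<bullet> P e\<close> dissipates along the observer error \<open>e = xh - x\<close>,
  so \<open>e\<close> is bounded and vanishes identically when it starts at \<open>0\<close> without disturbance. Hence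
  \<open>xh\<close> follows \<open>xh' = A xh\<close> up to a bounded perturbation. The error at the transmission time \<open>k T\<close> is at most
  \<open>L k / N\<close> in the max norm, and the contractive recursion keeps \<open>L\<close> bounded; Gronwall's
  inequality carries the bound across one transmission interval. This never compares
  \<^const>\<open>colsum_norm\<close> with the max norm: any growth rate of \<open>A\<close> over a single interval will do.\<close>

lemma has_derivative_path_integral:
  assumes "has_derivative_path x f" "0 \<le> a" "a \<le> b"
  shows "(f has_integral (x b - x a)) {a..b}"
proof -
  have *: "(f has_integral (x b - x 0)) {0..b}" "(f has_integral (x a - x 0)) {0..a}"
    using assms unfolding has_derivative_path_def by auto
  have "f integrable_on {a..b}"
    using integrable_subinterval_real[OF has_integral_integrable[OF *(1)]] assms by auto
  then obtain I where I: "(f has_integral I) {a..b}" by (auto simp: integrable_on_def)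
  have "(f has_integral (x a - x 0 + I)) {0..b}"
    using has_integral_combine[OF assms(2,3) *(2) I] .
  then have "x a - x 0 + I = x b - x 0" using *(1) has_integral_unique by blast
  then have "I = x b - x a" by (simp add: algebra_simps)
  with I show ?thesis by simp
qed

lemma has_derivative_path_shift:
  assumes "has_derivative_path x f" "0 \<le> a"
  shows "has_derivative_path (\<lambda>s. x (a + s)) (\<lambda>s. f (a + s))"
  unfolding has_derivative_path_def
proof (intro allI impI)
  fix t :: real assume "0 \<le> t"
  then have "(f has_integral (x (a + t) - x a)) {0 + a..t + a}"
    using has_derivative_path_integral[OF assms, of "a + t"] by (simp add: add.commute)
  then show "((\<lambda>s. f (a + s)) has_integral x (a + t) - x (a + 0)) {0..t}"
    unfolding has_integral_shift_Icc_real[symmetric] by (simp add: o_def)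
qed

lemma has_derivative_path_diff:
  assumes "has_derivative_path x f" "has_derivative_path z g"
    and "\<And>t. 0 \<le> t \<Longrightarrow> f t - g t = h t"
  shows "has_derivative_path (\<lambda>t. x t - z t) h"
  unfolding has_derivative_path_def
proof (intro allI impI)
  fix t :: real assume "0 \<le> t"
  then have "((\<lambda>s. f s - g s) has_integral ((x t - x 0) - (z t - z 0))) {0..t}"
    using assms unfolding has_derivative_path_def by (intro has_integral_diff) auto
  then have "(h has_integral ((x t - x 0) - (z t - z 0))) {0..t}"
    by (rule has_integral_eq[rotated]) (simp add: assms(3))
  then show "(h has_integral x t - z t - (x 0 - z 0)) {0..t}" by (simp add: algebra_simps)
qed

lemma has_derivative_path_continuous:
  assumes "has_derivative_path x f"
  shows "continuous_on {0..t} x"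
proof (cases "0 \<le> t")
  case True
  then have "f integrable_on {0..t}"
    using assms unfolding has_derivative_path_def by blast
  then have "continuous_on {0..t} (\<lambda>s. x 0 + integral {0..s} f)"
    by (intro continuous_intros indefinite_integral_continuous_1)
  moreover have "x 0 + integral {0..s} f = x s" if "s \<in> {0..t}" for s
  proof -
    have "(f has_integral (x s - x 0)) {0..s}"
      using assms that unfolding has_derivative_path_def by auto
    then show ?thesis by (simp add: integral_unique)
  qed
  ultimately show ?thesis by (rule continuous_on_eq)
qed simp

lemma matrix_vector_norm_bound:
  obtains a :: real where "0 \<le> a" "\<And>v. norm ((M :: real^'n^'m) *v v) \<le> a * norm v"
  using onorm[OF matrix_vector_mul_bounded_linear] onorm_pos_le[OF matrix_vector_mul_bounded_linear]
  by blast

lemma gronwall_integral: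
  fixes f :: "real \<Rightarrow> real"
  assumes cont: "continuous_on {0..\<tau>} f" and a: "0 \<le> a"
    and le: "\<And>s. s \<in> {0..\<tau>} \<Longrightarrow> f s \<le> c + a * integral {0..s} f"
    and s: "s \<in> {0..\<tau>}"
  shows "f s \<le> c * exp (a * s)"
proof -
  define F where "F r = integral {0..r} f" for r
  define \<phi> where "\<phi> r = exp (- a * r) * (c + a * F r)" for r
  have "\<phi> s \<le> \<phi> 0"
  proof (rule DERIV_nonpos_imp_decreasing_open[where a=0 and b=s])
    show "0 \<le> s" using s by simp
    have "continuous_on {0..s} F"
      unfolding F_def using cont s
      by (intro indefinite_integral_continuous_1 integrable_continuous_interval
          continuous_on_subset[OF cont]) auto
    then show "continuous_on {0..s} \<phi>" unfolding \<phi>_def by (intro continuous_intros)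
  next
    fix r assume r: "0 < r" "r < s"
    have "(F has_real_derivative f r) (at r within {0..\<tau>})"
      unfolding F_def using integral_has_real_derivative[OF cont, of r] r s by auto
    moreover have "at r within {0..\<tau>} = at r"
      using r s by (intro at_within_interior) auto
    ultimately have F: "(F has_real_derivative f r) (at r)" by simp
    have "(\<phi> has_real_derivative exp (- a * r) * (a * (f r - (c + a * F r)))) (at r)"
      unfolding \<phi>_def by (rule derivative_eq_intros F refl)+ (simp add: algebra_simps)
    moreover have "exp (- a * r) * (a * (f r - (c + a * F r))) \<le> 0"
      using le[of r] r s a unfolding F_def by (intro mult_nonneg_nonpos) auto
    ultimately show "\<exists>y. (\<phi> has_real_derivative y) (at r) \<and> y \<le> 0" by blast
  qed
  then have "exp (- a * s) * (c + a * F s) \<le> c" unfolding \<phi>_def F_def by simp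
  then have "c + a * F s \<le> c * exp (a * s)"
    by (simp add: exp_minus field_simps)
  with le[OF s] show ?thesis unfolding F_def by linarith
qed

lemma perturbed_linear_growth:
  fixes z :: "real \<Rightarrow> real^'n" and M :: "real^'n^'n"
  assumes path: "has_derivative_path z (\<lambda>t. M *v z t + g t)"
    and g: "\<And>t. 0 \<le> t \<Longrightarrow> norm (g t) \<le> \<gamma>"
    and a: "0 \<le> a" "\<And>v. norm (M *v v) \<le> a * norm v"
    and s: "0 \<le> s" "s \<le> \<tau>"
  shows "norm (z s) \<le> (norm (z 0) + \<gamma> * \<tau>) * exp (a * \<tau>)"
proof -
  have \<gamma>: "0 \<le> \<gamma>" using g[of 0] norm_ge_zero[of "g 0"] by linarith
  have cont: "continuous_on {0..\<tau>} (\<lambda>t. norm (z t))"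
    using has_derivative_path_continuous[OF path] by (intro continuous_intros)
  have "norm (z s) \<le> (norm (z 0) + \<gamma> * \<tau>) * exp (a * s)"
  proof (rule gronwall_integral[OF cont a(1)])
    fix r assume r: "r \<in> {0..\<tau>}"
    have h: "((\<lambda>t. M *v z t + g t) has_integral (z r - z 0)) {0..r}"
      using path r unfolding has_derivative_path_def by auto
    have i: "(\<lambda>t. norm (z t)) integrable_on {0..r}"
      using r by (intro integrable_continuous_interval continuous_on_subset[OF cont]) auto
    then have i': "((\<lambda>t. a * norm (z t) + \<gamma>) has_integral
        (a * integral {0..r} (\<lambda>t. norm (z t)) + \<gamma> * r)) {0..r}"
      using r has_integral_const_real[of \<gamma> 0 r]
      by (intro has_integral_add has_integral_mult_right integrable_integral)
         (auto simp: mult.commute)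
    have "norm (z r - z 0) \<le> a * integral {0..r} (\<lambda>t. norm (z t)) + \<gamma> * r"
      using integral_norm_bound_integral[OF has_integral_integrable[OF h] has_integral_integrable[OF i']]
        integral_unique[OF h] integral_unique[OF i']
      by (smt (verit) a(2) atLeastAtMost_iff g norm_triangle_ineq)
    moreover have "\<gamma> * r \<le> \<gamma> * \<tau>" using \<gamma> r by (intro mult_left_mono) auto
    moreover have "norm (z r) \<le> norm (z 0) + norm (z r - z 0)" by (rule norm_triangle_sub)
    ultimately show "norm (z r) \<le> norm (z 0) + \<gamma> * \<tau> + a * integral {0..r} (\<lambda>t. norm (z t))"
      by linarith
  qed (use s in auto)
  also have "\<dots> \<le> (norm (z 0) + \<gamma> * \<tau>) * exp (a * \<tau>)"
    using \<gamma> s a by (intro mult_left_mono) (auto intro!: mult_left_mono add_nonneg_nonneg)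
  finally show ?thesis .
qed

lemma summable_exp_series:
  fixes F :: "'a::banach \<Rightarrow> 'a"
  assumes b: "0 \<le> b" and F: "\<And>x. norm (F x) \<le> b * norm x"
  shows "summable (\<lambda>k. (s ^ k / fact k) *\<^sub>R (F ^^ k) x)"
proof (rule summable_comparison_test')
  have *: "norm ((F ^^ k) x) \<le> b ^ k * norm x" for k
  proof (induction k)
    case (Suc k)
    have "norm ((F ^^ Suc k) x) \<le> b * norm ((F ^^ k) x)" using F by simp
    also have "\<dots> \<le> b * (b ^ k * norm x)" using Suc b by (intro mult_left_mono)
    finally show ?case by simp
  qed simp
  show "summable (\<lambda>k. norm x * (inverse (fact k) * (\<bar>s\<bar> * b) ^ k))"
    by (intro summable_mult summable_exp)
  show "norm ((s ^ k / fact k) *\<^sub>R (F ^^ k) x) \<le> norm x * (inverse (fact k) * (\<bar>s\<bar> * b) ^ k)"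
    for k
    using mult_left_mono[OF *[of k], of "\<bar>s\<bar> ^ k / fact k"]
    by (simp add: power_abs power_mult_distrib field_simps)
qed

lemma mat_exp_scaleR_vector:
  fixes A :: "real^'n^'n"
  shows "mat_exp (s *\<^sub>R A) *v p = (\<Sum>k. (s ^ k / fact k) *\<^sub>R ((*v) A ^^ k) p)"
proof -
  have lin: "bounded_linear ((**) A :: real^'n^'n \<Rightarrow> real^'n^'n)"
    by (rule linear_conv_bounded_linear[THEN iffD1], rule linearI)
       (simp_all add: matrix_add_ldistrib matrix_scalar_ac scalar_matrix_assoc)
  obtain b where b: "0 \<le> b" "\<And>X :: real^'n^'n. norm (A ** X) \<le> b * norm X"
    using bounded_linear.nonneg_bounded[OF lin] by (metis mult.commute)
  have pow: "(((**) (s *\<^sub>R A)) ^^ k) X = s ^ k *\<^sub>R ((((**) A) ^^ k) X)" for k and X :: "real^'n^'n"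
    by (induction k) (simp_all add: scalar_matrix_assoc[symmetric] matrix_scalar_ac)
  have vec: "(((**) A ^^ k) (mat 1)) *v p = ((*v) A ^^ k) p" for k
    by (induction k) (simp_all add: matrix_vector_mul_assoc[symmetric])
  have bl: "bounded_linear (\<lambda>X::real^'n^'n. X *v p)"
    by (rule linear_conv_bounded_linear[THEN iffD1], rule linearI)
       (simp_all add: matrix_vector_mult_add_rdistrib scaleR_matrix_vector_assoc)
  have "mat_exp (s *\<^sub>R A) = (\<Sum>k. (s ^ k / fact k) *\<^sub>R ((**) A ^^ k) (mat 1))"
    unfolding mat_exp_def pow by simp
  then show ?thesis
    using bounded_linear.suminf[OF bl summable_exp_series[OF b, where s=s and x="mat 1"]]
    by (simp add: scaleR_matrix_vector_assoc[symmetric] vec)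
qed

lemma mat_exp_zero_vector: "mat_exp (0 *\<^sub>R A) *v p = p"
proof -
  have "(\<lambda>k. (0 ^ k / fact k) *\<^sub>R ((*v) A ^^ k) p) = (\<lambda>k. if k = 0 then p else 0)"
    by (auto simp: fun_eq_iff)
  then show ?thesis unfolding mat_exp_scaleR_vector
    using sums_unique[OF sums_single[of 0 "\<lambda>_. p"]] by simp
qed

lemma has_vector_derivative_mat_exp_vector:
  fixes A :: "real^'n^'n"
  shows "((\<lambda>s. mat_exp (s *\<^sub>R A) *v p) has_vector_derivative
      A *v (mat_exp (s *\<^sub>R A) *v p)) (at s)"
proof -
  obtain b where b: "0 \<le> b" "\<And>v. norm (A *v v) \<le> b * norm v"
    using matrix_vector_norm_bound[of A] by blast
  let ?v = "\<lambda>k. ((*v) A ^^ k) p"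
  have sm: "summable (\<lambda>k. (s ^ k / fact k) *\<^sub>R ?v k)" for s
    by (rule summable_exp_series[OF b])
  have "((\<lambda>s. (mat_exp (s *\<^sub>R A) *v p) \<bullet> i) has_real_derivative
      (A *v (mat_exp (s *\<^sub>R A) *v p)) \<bullet> i) (at s)" for i
  proof -
    define c where "c k = (?v k \<bullet> i) / fact k" for k
    have ser: "(mat_exp (s *\<^sub>R A) *v p) \<bullet> i = (\<Sum>k. c k * s ^ k)" and
         sc: "summable (\<lambda>k. c k * s ^ k)" for s
      using bounded_linear.suminf[OF bounded_linear_inner_left sm]
        bounded_linear.summable[OF bounded_linear_inner_left sm]
      by (simp_all add: mat_exp_scaleR_vector c_def mult.commute)
    have "diffs c k = (A *v ?v k) \<bullet> i / fact k" for k
      unfolding diffs_def c_def by (simp add: field_simps del: of_nat_Suc)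
    moreover have "(A *v (mat_exp (s *\<^sub>R A) *v p)) \<bullet> i = (\<Sum>k. (A *v ?v k) \<bullet> i / fact k * s ^ k)"
      using bounded_linear.suminf[OF bounded_linear_compose[OF bounded_linear_inner_left
            matrix_vector_mul_bounded_linear[of A]] sm]
      by (simp add: mat_exp_scaleR_vector matrix_vector_mult_scaleR mult.commute)
    ultimately show ?thesis
      using termdiffs_strong_converges_everywhere[OF sc, of s] ser by simp
  qed
  then have "((\<lambda>s. (mat_exp (s *\<^sub>R A) *v p) \<bullet> i) has_derivative
      (\<lambda>h. (h *\<^sub>R (A *v (mat_exp (s *\<^sub>R A) *v p))) \<bullet> i)) (at s)" for i
    by (simp add: has_field_derivative_def mult_commute_abs)
  then show ?thesis
    unfolding has_vector_derivative_def
    by (subst has_derivative_componentwise_within) blast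
qed

lemma has_derivative_path_mat_exp:
  "has_derivative_path (\<lambda>s. mat_exp (s *\<^sub>R A) *v p) (\<lambda>s. A *v (mat_exp (s *\<^sub>R A) *v p))"
  unfolding has_derivative_path_def
  by (intro allI impI fundamental_theorem_of_calculus)
     (auto intro: has_vector_derivative_at_within has_vector_derivative_mat_exp_vector)

lemma inner_matrix_vector: "v \<bullet> ((M :: real^'n^'m) *v w) = (transpose M *v v) \<bullet> w"
  by (metis dot_lmul_matrix vector_transpose_matrix transpose_transpose)

lemma symmetric_min_eigenvalue:
  fixes P :: "real^'n^'n"
  assumes sym: "transpose P = P"
  obtains \<mu> where "\<mu> \<in> eigenvalues P" "\<And>v. \<mu> * (v \<bullet> v) \<le> v \<bullet> (P *v v)"
proof -
  have cont: "continuous_on (sphere 0 1) (\<lambda>v. v \<bullet> (P *v v))"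
    by (intro continuous_intros matrix_vector_mult_linear_continuous_on)
  have "sphere (0 :: real^'n) 1 \<noteq> {}" by simp
  then obtain v0 where v0: "v0 \<in> sphere 0 1"
    and min: "\<And>v. v \<in> sphere 0 1 \<Longrightarrow> v0 \<bullet> (P *v v0) \<le> v \<bullet> (P *v v)"
    using continuous_attains_inf[OF compact_sphere _ cont] by blast
  define \<mu> where "\<mu> = v0 \<bullet> (P *v v0)"
  have low: "\<mu> * (v \<bullet> v) \<le> v \<bullet> (P *v v)" for v
  proof (cases "v = 0")
    case False
    define w where "w = v /\<^sub>R norm v"
    have "w \<in> sphere 0 1" using False by (simp add: w_def)
    then have "\<mu> \<le> w \<bullet> (P *v w)" unfolding \<mu>_def by (rule min)
    also have "w \<bullet> (P *v w) = (v \<bullet> (P *v v)) / (v \<bullet> v)"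
      by (simp add: w_def matrix_vector_mult_scaleR dot_square_norm power2_eq_square divide_inverse)
    finally show ?thesis using False by (simp add: pos_le_divide_eq)
  qed simp
  define D where "D w = P *v w - \<mu> *\<^sub>R w" for w
  have v0_sq: "v0 \<bullet> v0 = 1" using v0 by (simp add: dot_square_norm)
  \<comment> \<open>\<open>D\<close> is positive semidefinite and its quadratic form vanishes at \<open>v0\<close>, hence so does the
     linear term of the form along every line through \<open>v0\<close>.\<close>
  have "D v0 \<bullet> D v0 = 0"
  proof (rule ccontr)
    assume "D v0 \<bullet> D v0 \<noteq> 0"
    then have pos: "D v0 \<bullet> D v0 > 0" by simp
    define p where "p = D v0 \<bullet> D v0"
    define q where "q = D v0 \<bullet> D (D v0)"
    have form: "0 \<le> - (2 * t * p) + t\<^sup>2 * q" for t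
    proof -
      let ?v = "v0 - t *\<^sub>R D v0"
      have "0 \<le> ?v \<bullet> (P *v ?v) - \<mu> * (?v \<bullet> ?v)" using low[of ?v] by simp
      also have "\<dots> = ?v \<bullet> D ?v" by (simp add: D_def inner_diff_right)
      also have "D ?v = D v0 - t *\<^sub>R D (D v0)"
        by (simp add: D_def algebra_simps matrix_vector_mult_diff_distrib matrix_vector_mult_scaleR)
      also have "?v \<bullet> (D v0 - t *\<^sub>R D (D v0))
          = v0 \<bullet> D v0 - t * p - t * (v0 \<bullet> D (D v0)) + t\<^sup>2 * q"
        by (simp add: inner_diff_left inner_diff_right p_def q_def power2_eq_square algebra_simps)
      also have "v0 \<bullet> D v0 = 0" using v0_sq by (simp add: D_def inner_diff_right \<mu>_def)
      also have "v0 \<bullet> D (D v0) = p"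
        unfolding p_def D_def[of "D v0"]
        by (simp add: inner_diff_right inner_matrix_vector sym)
           (simp add: D_def inner_diff_left)
      finally show ?thesis by (simp add: algebra_simps)
    qed
    have *: "t * (2 * p) \<le> t * (t * q)" for t using form[of t] by (simp add: power2_eq_square algebra_simps)
    define t where "t = p / (\<bar>q\<bar> + 1)"
    have p: "p > 0" using pos by (simp add: p_def)
    then have "t > 0" by (simp add: t_def)
    then have "2 * p \<le> t * q" using *[of t] by (simp only: mult_le_cancel_left_pos)
    also have "\<dots> \<le> t * (\<bar>q\<bar> + 1)" using \<open>t > 0\<close> by (intro mult_left_mono) auto
    also have "\<dots> = p" by (simp add: t_def add_pos_nonneg)
    finally show False using p by simp
  qed
  then have "P *v v0 = \<mu> *\<^sub>R v0" by (simp add: D_def)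
  moreover have "v0 \<noteq> 0" using v0_sq by auto
  ultimately have "\<mu> \<in> eigenvalues P" unfolding eigenvalues_def by blast
  with low show ?thesis by (rule that[rotated])
qed

lemma finite_eigenvalues_symmetric:
  fixes P :: "real^'n^'n"
  assumes sym: "transpose P = P"
  shows "finite (eigenvalues P)"
proof -
  define f where "f l = (SOME v. v \<noteq> 0 \<and> P *v v = l *\<^sub>R v)" for l
  have f: "f l \<noteq> 0" "P *v f l = l *\<^sub>R f l" if "l \<in> eigenvalues P" for l
    using that someI_ex[of "\<lambda>v. v \<noteq> 0 \<and> P *v v = l *\<^sub>R v"]
    unfolding eigenvalues_def f_def by auto
  have orth: "f l \<bullet> f m = 0" if "l \<in> eigenvalues P" "m \<in> eigenvalues P" "l \<noteq> m" for l m
  proof -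
    have "m * (f l \<bullet> f m) = l * (f l \<bullet> f m)"
      using inner_matrix_vector[of "f l" P "f m"] f that by (simp add: sym)
    with that show ?thesis by simp
  qed
  have "pairwise orthogonal (f ` eigenvalues P)"
    unfolding pairwise_def orthogonal_def using orth by blast
  then have "finite (f ` eigenvalues P)" by (rule pairwise_orthogonal_imp_finite)
  moreover have "inj_on f (eigenvalues P)"
    using orth f(1) by (metis inj_onI inner_eq_zero_iff)
  ultimately show ?thesis by (rule finite_imageD)
qed

lemma pos_def_eigenvalues_pos:
  assumes "pos_def P" "l \<in> eigenvalues P"
  shows "l > 0"
proof -
  obtain v where v: "v \<noteq> 0" "P *v v = l *\<^sub>R v" using assms unfolding eigenvalues_def by blast
  then have "0 < l * (v \<bullet> v)" using assms unfolding pos_def_def by (metis inner_scaleR_right)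
  then show ?thesis by (meson inner_ge_zero linorder_not_less mult_nonpos_nonneg)
qed

lemma pos_def_lambda_pos:
  assumes "pos_def P"
  shows "lambda_max P > 0" "lambda_min P > 0"
proof -
  have "finite (eigenvalues P)"
    using assms finite_eigenvalues_symmetric unfolding pos_def_def by blast
  moreover have "eigenvalues P \<noteq> {}"
    using assms symmetric_min_eigenvalue unfolding pos_def_def by blast
  ultimately show "lambda_max P > 0" "lambda_min P > 0"
    using pos_def_eigenvalues_pos[OF assms] unfolding lambda_max_def lambda_min_def by auto
qed

lemma pos_def_coercive:
  assumes "pos_def P"
  obtains b where "b > 0" "\<And>v. b * (norm v)\<^sup>2 \<le> v \<bullet> (P *v v)"
  using assms symmetric_min_eigenvalue pos_def_eigenvalues_pos
  unfolding pos_def_def by (metis dot_square_norm)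

lemma pos_def_matrix_inv:
  assumes "pos_def (P :: real^'n^'n)"
  shows "P ** matrix_inv P = mat 1"
proof -
  have "v = 0" if "P *v v = 0" for v
    using assms that unfolding pos_def_def by force
  then have "invertible P"
    using matrix_left_invertible_ker[of P] invertible_left_inverse[of P] by blast
  then show ?thesis
    unfolding invertible_def matrix_inv_def by (rule someI2_ex) simp
qed

lemma sum_UNIV_Plus:
  "(\<Sum>i\<in>UNIV. f (i :: 'a::finite + 'b::finite)) = (\<Sum>a\<in>UNIV. f (Inl a)) + (\<Sum>b\<in>UNIV. f (Inr b))"
  unfolding UNIV_Plus_UNIV[symmetric] by (subst sum.Plus) simp_all

lemma block_mat_quadratic_form:
  fixes v :: "real^'n" and w :: "real^'m"
  defines "z \<equiv> (\<chi> i. case i of Inl a \<Rightarrow> v $ a | Inr b \<Rightarrow> w $ b)"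
  shows "z \<bullet> (block_mat M11 M12 M21 M22 *v z)
    = v \<bullet> (M11 *v v) + v \<bullet> (M12 *v w) + w \<bullet> (M21 *v v) + w \<bullet> (M22 *v w)"
proof -
  have l: "(block_mat M11 M12 M21 M22 *v z) $ Inl a = (M11 *v v) $ a + (M12 *v w) $ a"
   and r: "(block_mat M11 M12 M21 M22 *v z) $ Inr b = (M21 *v v) $ b + (M22 *v w) $ b" for a b
    by (simp_all add: matrix_vector_mult_def block_mat_def z_def sum_UNIV_Plus)
  show ?thesis
    unfolding inner_vec_def sum_UNIV_Plus l r
    by (simp add: z_def inner_vec_def sum.distrib algebra_simps)
qed

lemma LMI_dissipation:
  fixes A P :: "real^'n^'n" and H :: "real^'n^'y" and Q :: "real^'y^'n"
  assumes P: "pos_def P"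
    and LMI: "neg_semidef (block_mat
        (transpose A ** P + P ** A + transpose H ** transpose Q + Q ** H + \<nu>1 *\<^sub>R mat 1)
        P P (- (\<nu>2 *\<^sub>R mat 1)))"
  shows "2 * (v \<bullet> (P *v ((A + (matrix_inv P ** Q) ** H) *v v + w)))
    \<le> - \<nu>1 * (norm v)\<^sup>2 + \<nu>2 * (norm w)\<^sup>2"
proof -
  have sym: "transpose P = P" using P unfolding pos_def_def by simp
  let ?M = "transpose A ** P + P ** A + transpose H ** transpose Q + Q ** H + \<nu>1 *\<^sub>R mat 1"
  have "v \<bullet> (?M *v v) + v \<bullet> (P *v w) + w \<bullet> (P *v v) + w \<bullet> (- (\<nu>2 *\<^sub>R mat 1) *v w) \<le> 0"
    using LMI unfolding neg_semidef_def block_mat_quadratic_form[symmetric] by blast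
  moreover have "w \<bullet> (P *v v) = v \<bullet> (P *v w)"
    using inner_matrix_vector[of w P v] sym by (simp add: inner_commute)
  moreover have "w \<bullet> (- (\<nu>2 *\<^sub>R mat 1) *v w) = - \<nu>2 * (norm w)\<^sup>2"
    by (simp add: scaleR_minus_left[symmetric] scaleR_matrix_vector_assoc[symmetric]
        dot_square_norm del: scaleR_minus_left)
  moreover have "v \<bullet> (?M *v v) = 2 * (v \<bullet> (P *v (A *v v))) + 2 * (v \<bullet> (Q *v (H *v v))) + \<nu>1 * (norm v)\<^sup>2"
  proof -
    have "v \<bullet> (transpose A *v (P *v v)) = v \<bullet> (P *v (A *v v))"
      using inner_matrix_vector[of v "transpose A" "P *v v"] inner_matrix_vector[of "A *v v" P v] sym
      by (simp add: inner_commute)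
    moreover have "v \<bullet> (transpose H *v (transpose Q *v v)) = v \<bullet> (Q *v (H *v v))"
      using inner_matrix_vector[of v "transpose H" "transpose Q *v v"]
        inner_matrix_vector[of "H *v v" "transpose Q" v]
      by (simp add: inner_commute)
    ultimately show ?thesis
      by (simp add: matrix_vector_mult_add_rdistrib inner_add_right dot_square_norm
          matrix_vector_mul_assoc[symmetric] scaleR_matrix_vector_assoc[symmetric])
  qed
  moreover have "P *v ((A + (matrix_inv P ** Q) ** H) *v v + w) = P *v (A *v v) + Q *v (H *v v) + P *v w"
    using pos_def_matrix_inv[OF P]
    by (simp add: matrix_vector_mult_add_rdistrib matrix_vector_right_distrib
        matrix_vector_mul_assoc matrix_mul_assoc)
  ultimately show ?thesis by (simp add: inner_add_right)
qed

text \<open>The perturbation \<open>g\<close> is merely integrable, so \<open>e\<close> need not be differentiable; a first order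
  expansion at \<open>0\<close> takes the place of the derivative.\<close>

lemma path_first_order_expansion:
  fixes e :: "real \<Rightarrow> real^'n" and M :: "real^'n^'n"
  assumes path: "has_derivative_path e (\<lambda>t. M *v e t + g t)"
    and g: "\<And>t. 0 \<le> t \<Longrightarrow> norm (g t) \<le> \<gamma>"
    and \<epsilon>: "\<epsilon> > 0"
  obtains \<delta> where "\<delta> > 0" "\<And>h. \<lbrakk>0 < h; h < \<delta>\<rbrakk> \<Longrightarrow>
      \<exists>w r. norm w \<le> \<gamma> \<and> norm r \<le> \<epsilon> * h \<and> e h = e 0 + h *\<^sub>R (M *v e 0 + w) + r"
proof -
  have \<gamma>: "0 \<le> \<gamma>" using g[of 0] norm_ge_zero[of "g 0"] by linarith
  have cont: "continuous_on {0..t} (\<lambda>s. M *v e s)" for t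
    using has_derivative_path_continuous[OF path, of t]
    by (rule continuous_on_compose2[OF matrix_vector_mult_linear_continuous_on[of UNIV]]) auto
  obtain \<delta> where \<delta>: "\<delta> > 0"
    "\<And>s. s \<in> {0..1} \<Longrightarrow> dist s 0 < \<delta> \<Longrightarrow> dist (M *v e s) (M *v e 0) < \<epsilon>"
    using cont[of 1] \<epsilon> unfolding continuous_on_iff by (metis atLeastAtMost_iff order_refl zero_le_one)
  show ?thesis
  proof (rule that[of "min \<delta> 1"])
    show "min \<delta> 1 > 0" using \<delta> by simp
    fix h :: real assume h: "0 < h" "h < min \<delta> 1"
    have f: "((\<lambda>t. M *v e t + g t) has_integral (e h - e 0)) {0..h}"
      using path h unfolding has_derivative_path_def by auto
    have Me: "((\<lambda>t. M *v e t) has_integral integral {0..h} (\<lambda>t. M *v e t)) {0..h}"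
      using cont by (intro integrable_integral integrable_continuous_interval)
    define G where "G = e h - e 0 - integral {0..h} (\<lambda>t. M *v e t)"
    have "((\<lambda>t. M *v e t + g t - M *v e t) has_integral G) {0..h}"
      unfolding G_def using f Me by (rule has_integral_diff)
    then have "norm G \<le> \<gamma> * measure lborel {0..h}"
      using \<gamma> g by (intro has_integral_bound_real[where S="{}" and f=g]) auto
    then have G: "norm G \<le> h * \<gamma>" using h by (simp add: mult.commute)
    define r where "r = integral {0..h} (\<lambda>t. M *v e t) - h *\<^sub>R (M *v e 0)"
    have "((\<lambda>t. M *v e t - M *v e 0) has_integral r) {0..h}"
      unfolding r_def using has_integral_diff[OF Me has_integral_const_real[of "M *v e 0" 0 h]] h
      by simp
    moreover have "norm (M *v e t - M *v e 0) \<le> \<epsilon>" if "t \<in> {0..h}" for t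
      using \<delta>(2)[of t] that h by (simp add: dist_norm less_imp_le)
    ultimately have "norm r \<le> \<epsilon> * measure lborel {0..h}"
      using \<epsilon> by (intro has_integral_bound_real[where S="{}"]) auto
    then have r: "norm r \<le> \<epsilon> * h" using h by simp
    have "norm (G /\<^sub>R h) \<le> \<gamma>" using G h by (simp add: field_simps)
    moreover have "e h = e 0 + h *\<^sub>R (M *v e 0 + G /\<^sub>R h) + r"
      using h by (simp add: G_def r_def scaleR_right_distrib)
    ultimately show "\<exists>w r. norm w \<le> \<gamma> \<and> norm r \<le> \<epsilon> * h \<and> e h = e 0 + h *\<^sub>R (M *v e 0 + w) + r"
      using r by blast
  qed
qed

lemma quadratic_form_decrease:
  fixes e :: "real \<Rightarrow> real^'n" and M P :: "real^'n^'n"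
  assumes path: "has_derivative_path e (\<lambda>t. M *v e t + g t)"
    and g: "\<And>t. 0 \<le> t \<Longrightarrow> norm (g t) \<le> \<gamma>"
    and sym: "transpose P = P"
    and diss: "\<And>w. norm w \<le> \<gamma> \<Longrightarrow> 2 * (e 0 \<bullet> (P *v (M *v e 0 + w))) \<le> - \<kappa>"
    and \<kappa>: "\<kappa> > 0"
  obtains \<delta> where "\<delta> > 0"
    "\<And>h. \<lbrakk>0 < h; h < \<delta>\<rbrakk> \<Longrightarrow> e h \<bullet> (P *v e h) < e 0 \<bullet> (P *v e 0)"
proof -
  have \<gamma>: "0 \<le> \<gamma>" using g[of 0] norm_ge_zero[of "g 0"] by linarith
  obtain c where c: "0 \<le> c" "\<And>v. norm (P *v v) \<le> c * norm v"
    using matrix_vector_norm_bound[of P] by blast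
  define p where "p = norm (P *v e 0)"
  define \<epsilon> where "\<epsilon> = \<kappa> / (4 * (p + 1))"
  have p: "0 \<le> p" by (simp add: p_def)
  have \<epsilon>: "\<epsilon> > 0" and \<epsilon>p: "2 * (p * \<epsilon>) \<le> \<kappa> / 2"
    using \<kappa> p by (auto simp: \<epsilon>_def field_simps add_pos_nonneg)
  define s where "s = norm (M *v e 0) + \<gamma> + \<epsilon>"
  have s: "0 \<le> s" using \<gamma> \<epsilon> by (simp add: s_def)
  obtain \<delta> where \<delta>: "\<delta> > 0" "\<And>h. \<lbrakk>0 < h; h < \<delta>\<rbrakk> \<Longrightarrow>
      \<exists>w r. norm w \<le> \<gamma> \<and> norm r \<le> \<epsilon> * h \<and> e h = e 0 + h *\<^sub>R (M *v e 0 + w) + r"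
    using path_first_order_expansion[OF path g \<epsilon>] by blast
  define \<delta>' where "\<delta>' = \<kappa> / (2 * (c * s\<^sup>2 + 1))"
  have cs: "0 \<le> c * s\<^sup>2" using c by simp
  have "\<delta>' > 0" using \<kappa> cs by (simp add: \<delta>'_def add_nonneg_pos)
  show ?thesis
  proof (rule that[of "min \<delta> \<delta>'"])
    show "min \<delta> \<delta>' > 0" using \<delta> \<open>\<delta>' > 0\<close> by simp
    fix h assume h: "0 < h" "h < min \<delta> \<delta>'"
    then obtain w r where w: "norm w \<le> \<gamma>" and r: "norm r \<le> \<epsilon> * h"
      and e: "e h = e 0 + h *\<^sub>R (M *v e 0 + w) + r" using \<delta>(2)[of h] by auto
    define \<Delta> where "\<Delta> = h *\<^sub>R (M *v e 0 + w) + r"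
    have eh: "e h = e 0 + \<Delta>" using e by (simp add: \<Delta>_def)
    have "norm \<Delta> \<le> h * norm (M *v e 0 + w) + norm r"
      unfolding \<Delta>_def using norm_triangle_ineq[of "h *\<^sub>R (M *v e 0 + w)" r] h by simp
    also have "\<dots> \<le> h * (norm (M *v e 0) + \<gamma>) + \<epsilon> * h"
      using r h w norm_triangle_ineq[of "M *v e 0" w] by (intro add_mono mult_left_mono) auto
    also have "\<dots> = h * s" by (simp add: s_def algebra_simps)
    finally have \<Delta>: "norm \<Delta> \<le> h * s" .
    have "\<Delta> \<bullet> (P *v \<Delta>) \<le> norm \<Delta> * norm (P *v \<Delta>)" by (rule norm_cauchy_schwarz)
    also have "\<dots> \<le> norm \<Delta> * (c * norm \<Delta>)" using c(2) by (intro mult_left_mono) auto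
    also have "\<dots> = c * (norm \<Delta>)\<^sup>2" by (simp add: power2_eq_square)
    also have "\<dots> \<le> c * (h * s)\<^sup>2" using c \<Delta> by (intro mult_left_mono power_mono) auto
    also have "\<dots> = h * (h * (c * s\<^sup>2))" by (simp add: power2_eq_square)
    finally have quad: "\<Delta> \<bullet> (P *v \<Delta>) \<le> h * (h * (c * s\<^sup>2))" .
    have "h * (c * s\<^sup>2) \<le> h * (c * s\<^sup>2 + 1)" using h by simp
    also have "\<dots> < \<delta>' * (c * s\<^sup>2 + 1)" using h cs by (intro mult_strict_right_mono) auto
    also have "\<dots> = \<kappa> / 2" using cs by (simp add: \<delta>'_def field_simps add_nonneg_pos)
    finally have small: "h * (c * s\<^sup>2) < \<kappa> / 2" .
    have "e 0 \<bullet> (P *v r) = (P *v e 0) \<bullet> r" using inner_matrix_vector[of "e 0" P r] sym by simp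
    also have "\<dots> \<le> p * norm r" unfolding p_def by (rule norm_cauchy_schwarz)
    also have "\<dots> \<le> p * (\<epsilon> * h)" using r p by (intro mult_left_mono)
    finally have "2 * (e 0 \<bullet> (P *v r)) \<le> h * (2 * (p * \<epsilon>))" by (simp add: algebra_simps)
    also have "\<dots> \<le> h * (\<kappa> / 2)" using \<epsilon>p h by (intro mult_left_mono) auto
    finally have rem: "2 * (e 0 \<bullet> (P *v r)) \<le> h * (\<kappa> / 2)" .
    have "2 * (e 0 \<bullet> (P *v \<Delta>)) = h * (2 * (e 0 \<bullet> (P *v (M *v e 0 + w)))) + 2 * (e 0 \<bullet> (P *v r))"
      by (simp add: \<Delta>_def matrix_vector_right_distrib matrix_vector_mult_scaleR inner_add_right
          algebra_simps)
    also have "\<dots> \<le> h * (- \<kappa>) + h * (\<kappa> / 2)"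
      using diss[OF w] rem h by (intro add_mono mult_left_mono) auto
    finally have lin: "2 * (e 0 \<bullet> (P *v \<Delta>)) \<le> - (h * (\<kappa> / 2))" by (simp add: mult.commute)
    have "\<Delta> \<bullet> (P *v e 0) = e 0 \<bullet> (P *v \<Delta>)"
      using inner_matrix_vector[of \<Delta> P "e 0"] sym by (simp add: inner_commute)
    then have "e h \<bullet> (P *v e h) = e 0 \<bullet> (P *v e 0) + 2 * (e 0 \<bullet> (P *v \<Delta>)) + \<Delta> \<bullet> (P *v \<Delta>)"
      by (simp add: eh matrix_vector_right_distrib inner_add_left inner_add_right)
    moreover have "h * (h * (c * s\<^sup>2)) < h * (\<kappa> / 2)" using small h by (intro mult_strict_left_mono)
    ultimately show "e h \<bullet> (P *v e h) < e 0 \<bullet> (P *v e 0)" using quad lin by linarith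
  qed
qed

lemma quadratic_form_invariant_bound:
  fixes e :: "real \<Rightarrow> real^'n" and M P :: "real^'n^'n"
  assumes path: "has_derivative_path e (\<lambda>t. M *v e t + g t)"
    and g: "\<And>t. 0 \<le> t \<Longrightarrow> norm (g t) \<le> \<gamma>"
    and sym: "transpose P = P"
    and diss: "\<And>v w. 2 * (v \<bullet> (P *v (M *v v + w))) \<le> - \<nu>1 * (norm v)\<^sup>2 + \<nu>2 * (norm w)\<^sup>2"
    and \<nu>: "\<nu>1 > 0" "\<nu>2 > 0"
    and c: "\<And>v. v \<bullet> (P *v v) \<le> c * (norm v)\<^sup>2" "c > 0"
    and R: "e 0 \<bullet> (P *v e 0) \<le> R" "c * \<nu>2 * \<gamma>\<^sup>2 \<le> \<nu>1 * R"
    and t: "0 \<le> t"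
  shows "e t \<bullet> (P *v e t) \<le> R"
proof (rule ccontr)
  define V where "V s = e s \<bullet> (P *v e s)" for s
  assume "\<not> e t \<bullet> (P *v e t) \<le> R"
  then have Vt: "R < V t" by (simp add: V_def)
  define R' where "R' = (R + V t) / 2"
  have R': "R < R'" "R' < V t" using Vt by (simp_all add: R'_def)
  have contV: "continuous_on {a..b} V" if "0 \<le> a" for a b
  proof -
    have "continuous_on {a..b} e"
      using has_derivative_path_continuous[OF path, of b] that
      by (auto intro: continuous_on_subset)
    moreover have "continuous_on {a..b} (\<lambda>s. P *v e s)"
      using calculation
      by (rule continuous_on_compose2[OF matrix_vector_mult_linear_continuous_on[of UNIV]]) auto
    ultimately show ?thesis unfolding V_def by (rule continuous_on_inner)
  qed
  define S where "S = {s \<in> {0..t}. V s = R'}"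
  have "closed S" unfolding S_def by (rule continuous_closed_preimage_constant[OF contV]) auto
  moreover have "bounded S" unfolding S_def by (rule bounded_subset[of "{0..t}"]) auto
  moreover have "S \<noteq> {}"
    using IVT'[of V 0 R' t] contV[of 0 t] R R' t unfolding S_def V_def by auto
  ultimately obtain t0 where t0: "t0 \<in> S" and last: "\<And>s. s \<in> S \<Longrightarrow> s \<le> t0"
    using compact_attains_sup[of S] compact_eq_bounded_closed by metis
  have t0': "0 \<le> t0" "t0 < t" "V t0 = R'" using t0 R' unfolding S_def by (auto simp: less_le)
  define \<kappa> where "\<kappa> = \<nu>1 * (norm (e t0))\<^sup>2 - \<nu>2 * \<gamma>\<^sup>2"
  have "c * (\<nu>2 * \<gamma>\<^sup>2) < \<nu>1 * R'" using R(2) mult_strict_left_mono[OF R'(1) \<nu>(1)] by simp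
  also have "\<dots> \<le> \<nu>1 * (c * (norm (e t0))\<^sup>2)"
    using c(1)[of "e t0"] t0' \<nu> unfolding V_def by (intro mult_left_mono) auto
  finally have "c * (\<nu>2 * \<gamma>\<^sup>2) < c * (\<nu>1 * (norm (e t0))\<^sup>2)" by (simp add: algebra_simps)
  then have \<kappa>: "\<kappa> > 0" using c(2) by (simp add: \<kappa>_def)
  have dissw: "2 * (e (t0 + 0) \<bullet> (P *v (M *v e (t0 + 0) + w))) \<le> - \<kappa>" if "norm w \<le> \<gamma>" for w
  proof -
    have "\<nu>2 * (norm w)\<^sup>2 \<le> \<nu>2 * \<gamma>\<^sup>2" using that \<nu> by (intro mult_left_mono power_mono) auto
    then show ?thesis using diss[of "e t0" w] by (simp add: \<kappa>_def)
  qed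
  obtain \<delta> where \<delta>: "\<delta> > 0"
    "\<And>h. \<lbrakk>0 < h; h < \<delta>\<rbrakk> \<Longrightarrow> e (t0 + h) \<bullet> (P *v e (t0 + h)) < e (t0 + 0) \<bullet> (P *v e (t0 + 0))"
    using quadratic_form_decrease[OF has_derivative_path_shift[OF path t0'(1)] _ sym dissw \<kappa>]
      g t0' by (metis add_nonneg_nonneg)
  define h where "h = min (\<delta> / 2) (t - t0)"
  have h: "0 < h" "h < \<delta>" "t0 + h \<le> t" using \<delta>(1) t0' by (auto simp: h_def)
  have "V (t0 + h) < R'" using \<delta>(2)[OF h(1,2)] t0' by (simp add: V_def)
  then obtain s where "t0 + h \<le> s" "s \<le> t" "V s = R'"
    using IVT'[of V "t0 + h" R' t] contV[of "t0 + h" t] R' h t0' by force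
  then have "s \<in> S" using h t0' by (simp add: S_def)
  then show False using last[of s] \<open>t0 + h \<le> s\<close> h by simp
qed

lemma colsum_norm_nonneg: "0 \<le> colsum_norm M"
proof -
  have "(\<Sum>i\<in>UNIV. \<bar>M $ i $ j\<bar>) \<le> colsum_norm M" for j
    unfolding colsum_norm_def by (rule Max_ge) auto
  then show ?thesis using sum_nonneg order_trans by (metis abs_ge_zero)
qed

lemma colsum_norm_eq_0_iff: "colsum_norm M = 0 \<longleftrightarrow> M = 0"
proof
  assume 0: "colsum_norm M = 0"
  have "(\<Sum>i\<in>UNIV. \<bar>M $ i $ j\<bar>) \<le> 0" for j
    unfolding 0[symmetric] colsum_norm_def by (rule Max_ge) auto
  then have "\<bar>M $ i $ j\<bar> \<le> 0" for i j
    using member_le_sum[of i UNIV "\<lambda>i. \<bar>M $ i $ j\<bar>"] by (metis UNIV_I abs_ge_zero finite order_trans)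
  then show "M = 0" by (simp add: vec_eq_iff)
qed (simp add: colsum_norm_def)

lemma norm_hypercube_zero_le:
  fixes v :: "real^'n"
  assumes "v \<in> hypercube 0 l"
  shows "norm v \<le> sqrt CARD('n) * l"
proof -
  have "norm v \<le> sqrt CARD('n) * infnorm v" using norm_le_infnorm[of v] by simp
  also have "\<dots> \<le> sqrt CARD('n) * l"
    using assms by (intro mult_left_mono) (auto simp: hypercube_def)
  finally show ?thesis .
qed

text \<open>Since the index is not saturated, the bound holds outside the quantization region too.\<close>

lemma decode_encode_error:
  assumes "l > 0" "N > 0"
  shows "infnorm (x - decode N c l (encode N c l x)) \<le> l / real N"
  unfolding infnorm_cart
proof (rule cSup_least)
  fix r assume "r \<in> {\<bar>(x - decode N c l (encode N c l x)) $ i\<bar> |i. i \<in> UNIV}"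
  then obtain i where r: "r = \<bar>(x - decode N c l (encode N c l x)) $ i\<bar>" by auto
  define q where "q = (x $ i + l - c $ i) * (real N / (2 * l))"
  have x: "x $ i = c $ i - l + l / real N * (2 * q)" using assms by (simp add: q_def field_simps)
  have "(x - decode N c l (encode N c l x)) $ i = l / real N * (2 * frac q - 1)"
    using assms(1) by (simp add: decode_def encode_def x flip: q_def)
       (simp add: frac_def algebra_simps flip: add_divide_distrib)
  moreover have "\<bar>2 * frac q - 1\<bar> \<le> 1"
    using frac_ge_0[of q] frac_lt_1[of q] by linarith
  ultimately show "r \<le> l / real N"
    unfolding r using assms by (simp add: abs_mult mult_left_le divide_right_mono)
qed auto

lemma decode_encode_zero_range: "decode N c 0 (encode N c 0 x) = c"
  by (simp add: decode_def vec_eq_iff)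

lemma affine_recursion_bound:
  fixes L :: "nat \<Rightarrow> real"
  assumes "\<And>k. L (Suc k) = q * L k + \<beta> k" "0 \<le> q" "q < 1"
    and "\<And>k. 0 \<le> \<beta> k" "\<And>k. \<beta> k \<le> b" "0 \<le> L 0"
  shows "0 \<le> L k" "L k \<le> L 0 + b / (1 - q)"
proof -
  show "0 \<le> L k" by (induction k) (simp_all add: assms)
  have b: "0 \<le> b" using assms(4,5) order_trans by blast
  show "L k \<le> L 0 + b / (1 - q)"
  proof (induction k)
    case (Suc k)
    have "L (Suc k) \<le> q * (L 0 + b / (1 - q)) + b"
      unfolding assms(1) using Suc assms by (intro add_mono mult_left_mono)
    also have "\<dots> = q * L 0 + b / (1 - q)" using assms by (simp add: field_simps)
    also have "\<dots> \<le> L 0 + b / (1 - q)" using assms by (simp add: mult_left_le_one_le)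
    finally show ?case .
  qed (use assms b in simp)
qed

lemma lambda_e_pos:
  fixes P :: "real^'n^'n"
  assumes "pos_def P" "\<nu>1 > 0"
  shows "lambda_e P \<nu>1 > 0"
  using assms pos_def_lambda_pos[OF assms(1)] by (simp add: lambda_e_def)

lemma beta_d_bounds:
  fixes P :: "real^'n^'n"
  assumes P: "pos_def P" and \<nu>: "\<nu>1 > 0" "\<nu>2 > 0" and nn: "xb \<ge> 0" "db \<ge> 0" and t: "t \<ge> 0"
  shows "0 \<le> beta_d P \<nu>1 \<nu>2 xb db t" "beta_d P \<nu>1 \<nu>2 xb db t \<le> beta_d P \<nu>1 \<nu>2 xb db 0"
    and "beta_d P \<nu>1 \<nu>2 xb db t = 0 \<Longrightarrow> xb = 0 \<and> db = 0"
proof -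
  note pos = pos_def_lambda_pos[OF P] lambda_e_pos[OF P \<nu>(1)]
  define a where "a = sqrt (real CARD('n) * lambda_max P / lambda_min P)"
  define c where "c = sqrt (real CARD('n) * \<nu>2 / (lambda_min P * lambda_e P \<nu>1))"
  define E where "E t = exp (- lambda_e P \<nu>1 * t / 2)" for t
  have a: "a > 0" and c: "c > 0" using pos \<nu> by (simp_all add: a_def c_def)
  have E: "E t > 0" "E t \<le> E 0" using pos t by (simp_all add: E_def)
  have b: "beta_d P \<nu>1 \<nu>2 xb db t = a * E t * xb + c * db" for t
    unfolding beta_d_def a_def c_def E_def ..
  show "0 \<le> beta_d P \<nu>1 \<nu>2 xb db t" unfolding b using a c E nn by simp
  show "beta_d P \<nu>1 \<nu>2 xb db t \<le> beta_d P \<nu>1 \<nu>2 xb db 0"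
    unfolding b using a E nn by (intro add_mono mult_right_mono mult_left_mono) auto
  show "xb = 0 \<and> db = 0" if "beta_d P \<nu>1 \<nu>2 xb db t = 0"
  proof -
    have "0 \<le> a * E t * xb" "0 \<le> c * db" using a c E nn by simp_all
    with that have "a * E t * xb = 0" "c * db = 0" unfolding b by linarith+
    with a c E show ?thesis by simp
  qed
qed

lemma interval_index_bounds:
  assumes "T > 0" "t \<ge> 0"
  shows "0 \<le> t - real (interval_index T t) * T" "t - real (interval_index T t) * T \<le> T"
proof -
  have "real (interval_index T t) = of_int \<lfloor>t / T\<rfloor>"
    using assms by (simp add: interval_index_def)
  then have "real (interval_index T t) \<le> t / T" "t / T \<le> real (interval_index T t) + 1"
    by linarith+
  then show "0 \<le> t - real (interval_index T t) * T" "t - real (interval_index T t) * T \<le> T"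
    using assms by (simp_all add: field_simps)
qed

lemma observer_error_bounded:
  fixes A P :: "real^'n^'n" and H :: "real^'n^'y" and Q :: "real^'y^'n"
  assumes P: "pos_def P" and \<nu>: "\<nu>1 > 0" "\<nu>2 > 0"
    and LMI: "neg_semidef (block_mat
        (transpose A ** P + P ** A + transpose H ** transpose Q + Q ** H + \<nu>1 *\<^sub>R mat 1)
        P P (- (\<nu>2 *\<^sub>R mat 1)))"
    and path: "has_derivative_path e (\<lambda>t. (A + (matrix_inv P ** Q) ** H) *v e t + g t)"
    and g: "\<And>t. 0 \<le> t \<Longrightarrow> norm (g t) \<le> \<gamma>"
  shows "\<exists>b. \<forall>t\<ge>0. norm (e t) \<le> b"
    and "\<gamma> = 0 \<Longrightarrow> e 0 = 0 \<Longrightarrow> t \<ge> 0 \<Longrightarrow> e t = 0"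
proof -
  have sym: "transpose P = P" using P unfolding pos_def_def by simp
  obtain b where b: "b > 0" "\<And>v. b * (norm v)\<^sup>2 \<le> v \<bullet> (P *v v)" using pos_def_coercive[OF P] by blast
  obtain c0 where c0: "0 \<le> c0" "\<And>v. norm (P *v v) \<le> c0 * norm v"
    using matrix_vector_norm_bound[of P] by blast
  define c where "c = c0 + 1"
  have c: "c > 0" using c0 by (simp add: c_def)
  have up: "v \<bullet> (P *v v) \<le> c * (norm v)\<^sup>2" for v
  proof -
    have "v \<bullet> (P *v v) \<le> norm v * norm (P *v v)" by (rule norm_cauchy_schwarz)
    also have "\<dots> \<le> norm v * (c * norm v)"
      using c0(2)[of v] unfolding c_def by (intro mult_left_mono) (auto simp: algebra_simps intro: add_increasing)
    finally show ?thesis by (simp add: power2_eq_square algebra_simps)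
  qed
  define R where "R = max (e 0 \<bullet> (P *v e 0)) (c * \<nu>2 * \<gamma>\<^sup>2 / \<nu>1)"
  have R: "e 0 \<bullet> (P *v e 0) \<le> R" by (simp add: R_def)
  have R2: "c * \<nu>2 * \<gamma>\<^sup>2 \<le> \<nu>1 * R"
  proof -
    have "\<nu>1 * (c * \<nu>2 * \<gamma>\<^sup>2 / \<nu>1) \<le> \<nu>1 * R" using \<nu> by (intro mult_left_mono) (auto simp: R_def)
    then show ?thesis using \<nu> by simp
  qed
  have le: "b * (norm (e t))\<^sup>2 \<le> R" if "0 \<le> t" for t
    using b(2)[of "e t"] quadratic_form_invariant_bound[OF path g sym LMI_dissipation[OF P LMI] \<nu> up c R R2 that]
    by simp
  have "norm (e t) \<le> sqrt (R / b)" if "0 \<le> t" for t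
    using le[OF that] b by (intro real_le_rsqrt) (simp add: field_simps)
  then show "\<exists>b. \<forall>t\<ge>0. norm (e t) \<le> b" by blast
  show "e t = 0" if "\<gamma> = 0" "e 0 = 0" "t \<ge> 0"
  proof -
    have "R = 0" using that by (simp add: R_def)
    with le[OF that(3)] b show ?thesis by (simp add: mult_le_0_iff)
  qed
qed

theorem theorem3:
  fixes A :: "real^'n^'n" and B :: "real^'m^'n" and E :: "real^'o^'n" and H :: "real^'n^'y"
    and P :: "real^'n^'n" and Q :: "real^'y^'n" and K :: "real^'y^'n"
    and \<nu>1 \<nu>2 xb ub db T :: real and xc :: "real^'n" and N :: nat
    and u :: "real \<Rightarrow> real^'m" and d :: "real \<Rightarrow> real^'o" and y :: "real \<Rightarrow> real^'y"
    and x xh :: "real \<Rightarrow> real^'n"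
    and C Pd :: "nat \<Rightarrow> real^'n" and L :: "nat \<Rightarrow> real" and Pe :: "nat \<Rightarrow> int^'n"
  assumes observable: "observable A H"
    and A_nonzero: "A \<noteq> 0"
    and plant: "has_derivative_path x (\<lambda>t. A *v x t + B *v u t + E *v d t)"
    and measurement: "\<And>t. t \<ge> 0 \<Longrightarrow> y t = H *v x t"
    and bounds_nonneg: "xb \<ge> 0" "ub \<ge> 0" "db \<ge> 0"
    and initial_state: "x 0 \<in> hypercube xc xb"
    and input_bound: "\<And>t. t \<ge> 0 \<Longrightarrow> B *v u t \<in> hypercube 0 ub"
    and disturbance_bound: "\<And>t. t \<ge> 0 \<Longrightarrow> E *v d t \<in> hypercube 0 db"
    and gain: "pos_def P" "K = matrix_inv P ** Q"
    and \<nu>_pos: "\<nu>1 > 0" "\<nu>2 > 0"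
    and LMI: "neg_semidef (block_mat
        (transpose A ** P + P ** A + transpose H ** transpose Q + Q ** H + \<nu>1 *\<^sub>R mat 1)
        P P (- (\<nu>2 *\<^sub>R mat 1)))"
    and observer: "has_derivative_path xh
        (\<lambda>t. A *v xh t + B *v u t + K *v (H *v xh t - y t))"
      "xh 0 = xc"
    and T_pos: "T > 0" and N_pos: "N > 0"
    and quantizer_init: "C 0 = xc" "L 0 = xb" "Pd 0 = xc"
    and encoder: "\<And>k. Pe k = encode N (C k) (L k) (xh (real k * T))"
    and decoder: "\<And>k. k > 0 \<Longrightarrow> Pd k = decode N (C k) (L k) (Pe k)"
    and center_update: "\<And>k. C (Suc k) = mat_exp (T *\<^sub>R A) *v Pd k"
    and range_update: "\<And>k. L (Suc k) =
        exp (colsum_norm A * T) / real N * L k + beta_ue A H K P \<nu>1 \<nu>2 xb ub db T k"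
    and contraction: "exp (colsum_norm A * T) / real N < 1"
  shows "(\<exists>M. \<forall>t\<ge>0. infnorm (quantization_error A T xh Pd t) \<le> M)
    \<and> (bounded (x ` {0..}) \<longrightarrow> (\<exists>M. \<forall>t\<ge>0. infnorm (held_quantization_error T xh Pd t) \<le> M))"
proof -
  define e where "e t = xh t - x t" for t
  define g where "g t = B *v u t + (K ** H) *v e t" for t
  have e_path: "has_derivative_path e (\<lambda>t. (A + (matrix_inv P ** Q) ** H) *v e t + - (E *v d t))"
    unfolding e_def
    by (rule has_derivative_path_diff[OF observer(1) plant])
       (simp add: measurement gain(2)[symmetric] matrix_vector_mult_add_rdistrib
          matrix_vector_mult_diff_distrib matrix_vector_mul_assoc[symmetric] algebra_simps)
  have dist: "norm (- (E *v d t)) \<le> sqrt CARD('n) * db" if "0 \<le> t" for t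
    using norm_hypercube_zero_le[OF disturbance_bound[OF that]] by simp
  note obs = observer_error_bounded[OF gain(1) \<nu>_pos LMI e_path dist]
  obtain be where be: "\<And>t. 0 \<le> t \<Longrightarrow> norm (e t) \<le> be" using obs(1) by blast
  obtain a where a: "0 \<le> a" "\<And>v. norm (A *v v) \<le> a * norm v"
    using matrix_vector_norm_bound[of A] by blast
  obtain a' where a': "0 \<le> a'" "\<And>v. norm ((K ** H) *v v) \<le> a' * norm v"
    using matrix_vector_norm_bound[of "K ** H"] by blast
  define \<gamma> where "\<gamma> = sqrt CARD('n) * ub + a' * be"
  have g: "norm (g t) \<le> \<gamma>" if "0 \<le> t" for t
  proof -
    have "norm (g t) \<le> norm (B *v u t) + a' * norm (e t)"
      unfolding g_def by (rule norm_triangle_le) (use a' in simp)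
    also have "\<dots> \<le> \<gamma>" unfolding \<gamma>_def
      using norm_hypercube_zero_le[OF input_bound[OF that]] be[OF that] a'
      by (intro add_mono mult_left_mono)
    finally show ?thesis .
  qed

  define z where "z k s = xh (real k * T + s) - mat_exp (s *\<^sub>R A) *v Pd k" for k s
  have z_path: "has_derivative_path (z k) (\<lambda>s. A *v z k s + g (real k * T + s))" for k
    unfolding z_def
  proof (rule has_derivative_path_diff[OF has_derivative_path_shift[OF observer(1)]
        has_derivative_path_mat_exp])
    show "0 \<le> real k * T" using T_pos by simp
    then show "A *v xh (real k * T + s) + B *v u (real k * T + s)
        + K *v (H *v xh (real k * T + s) - y (real k * T + s))
        - A *v (mat_exp (s *\<^sub>R A) *v Pd k)
      = A *v (xh (real k * T + s) - mat_exp (s *\<^sub>R A) *v Pd k) + g (real k * T + s)"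
      if "0 \<le> s" for s
      using that by (simp add: measurement g_def e_def matrix_vector_mult_diff_distrib
          matrix_vector_mul_assoc[symmetric])
  qed
  have z0: "z k 0 = xh (real k * T) - Pd k" for k
    unfolding z_def mat_exp_zero_vector by simp
  have grow: "norm (z k s) \<le> (norm (z k 0) + \<gamma>' * T) * exp (a * T)"
    if "0 \<le> s" "s \<le> T" "\<And>t. 0 \<le> t \<Longrightarrow> norm (g t) \<le> \<gamma>'" for k s \<gamma>'
    using perturbed_linear_growth[OF z_path _ a that(1,2), of k \<gamma>'] that T_pos by simp

  define \<beta> where "\<beta> k = beta_ue A H K P \<nu>1 \<nu>2 xb ub db T k" for k
  define q where "q = exp (colsum_norm A * T) / real N"
  define c where "c = 1 / colsum_norm A * exp (colsum_norm A * T)"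
  define D where "D k = beta_d P \<nu>1 \<nu>2 xb db (real k * T)" for k
  define \<kappa> where "\<kappa> = colsum_norm (K ** H)"
  have c: "c > 0"
    using colsum_norm_nonneg[of A] colsum_norm_eq_0_iff[of A] A_nonzero
    unfolding c_def by (intro mult_pos_pos) auto
  have \<kappa>: "0 \<le> \<kappa>" unfolding \<kappa>_def by (rule colsum_norm_nonneg)
  have \<beta>: "\<beta> k = c * (ub + \<kappa> * D k)" for k
    unfolding \<beta>_def beta_ue_def c_def \<kappa>_def D_def ..
  have D: "0 \<le> D k" "D k \<le> D 0" "D k = 0 \<Longrightarrow> xb = 0 \<and> db = 0" for k
    unfolding D_def using beta_d_bounds[OF gain(1) \<nu>_pos bounds_nonneg(1,3), of "real k * T"] T_pos
    by simp_all
  have \<beta>_bounds: "0 \<le> \<beta> k" "\<beta> k \<le> \<beta> 0" for k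
    unfolding \<beta> using c \<kappa> D bounds_nonneg by (simp_all add: mult_left_mono)
  have q: "0 < q" "q < 1" using contraction N_pos unfolding q_def by simp_all
  have L_rec: "L (Suc k) = q * L k + \<beta> k" for k unfolding q_def \<beta>_def by (rule range_update)
  have L: "0 \<le> L k" "L k \<le> L 0 + \<beta> 0 / (1 - q)" for k
    using affine_recursion_bound[where L=L and \<beta>=\<beta> and q=q and b="\<beta> 0" and k=k]
      L_rec q \<beta>_bounds bounds_nonneg(1) quantizer_init(2) by auto

  have sampled: "\<exists>m. \<forall>k. norm (z k 0) \<le> m"
  proof (cases "\<exists>k. L (Suc k) = 0")
    case True
    \<comment> \<open>A vanishing range forces the encoder to send no information, which is harmless because then
       the decoder tracks the estimate exactly.\<close>
    then obtain k where "q * L k + \<beta> k = 0" using L_rec by auto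
    then have \<beta>k: "\<beta> k = 0" using L(1)[of k] \<beta>_bounds(1)[of k] q
      by (smt (verit) mult_nonneg_nonneg)
    have "L 0 = 0"
    proof (rule ccontr)
      assume "L 0 \<noteq> 0"
      then have "L 0 > 0" using L(1)[of 0] by simp
      then have "L j > 0" for j
        by (induction j) (use q \<beta>_bounds(1) in \<open>simp_all add: L_rec add_pos_nonneg\<close>)
      with True show False by (metis less_irrefl)
    qed
    then have xb: "xb = 0" using quantizer_init by simp
    have "ub + \<kappa> * D k = 0" using \<beta>k c unfolding \<beta> by simp
    moreover have "0 \<le> \<kappa> * D k" using \<kappa> D by simp
    ultimately have ub: "ub = 0" and "\<kappa> * D k = 0" using bounds_nonneg by linarith+
    then consider "\<kappa> = 0" | "db = 0" using D(3)[of k] by auto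
    then have KHe: "(K ** H) *v e t = 0" if "0 \<le> t" for t
    proof cases
      case 1
      then show ?thesis by (simp add: \<kappa>_def colsum_norm_eq_0_iff)
    next
      case 2
      have "infnorm (x 0 - xc) \<le> 0" using initial_state xb by (simp add: hypercube_def)
      then have "e 0 = 0" using observer(2)
        by (metis e_def eq_iff_diff_eq_0 infnorm_eq_0 infnorm_pos_le order_antisym)
      then show ?thesis using obs(2) 2 that by simp
    qed
    have g0: "norm (g t) \<le> 0" if "0 \<le> t" for t
      using norm_hypercube_zero_le[OF input_bound[OF that]] KHe[OF that] ub by (simp add: g_def)
    have D0: "\<kappa> * D j = 0" for j
      using \<open>\<kappa> * D k = 0\<close> xb by (simp add: D_def beta_d_def)
    have L0: "L j = 0" for j
    proof (induction j)
      case (Suc j)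
      then show ?case using D0[of j] ub by (simp add: L_rec \<beta>)
    qed (rule \<open>L 0 = 0\<close>)
    have "z j 0 = 0" for j
    proof (induction j)
      case 0
      then show ?case by (simp add: z0 quantizer_init observer(2))
    next
      case (Suc j)
      then have "z j T = 0" using grow[of T 0 j] g0 T_pos by simp
      then have "xh (real (Suc j) * T) = C (Suc j)"
        by (simp add: z_def center_update algebra_simps)
      moreover have "Pd (Suc j) = C (Suc j)"
        using decode_encode_zero_range by (simp add: decoder encoder L0)
      ultimately show ?case by (simp add: z0)
    qed
    then show ?thesis by (metis norm_zero order_refl)
  next
    case False
    have "norm (z k 0) \<le> sqrt CARD('n) * ((L 0 + \<beta> 0 / (1 - q)) / real N)" for k
    proof (cases k)
      case 0
      have "0 \<le> L 0 + \<beta> 0 / (1 - q)" using L order_trans by blast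
      with 0 show ?thesis by (simp add: z0 quantizer_init observer(2))
    next
      case (Suc j)
      then have "L k > 0" using False L(1)[of k] by (simp add: less_le)
      then have "infnorm (z k 0) \<le> L k / real N"
        using decode_encode_error[OF _ N_pos] Suc by (simp add: z0 decoder encoder)
      also have "\<dots> \<le> (L 0 + \<beta> 0 / (1 - q)) / real N" using L(2) by (intro divide_right_mono) auto
      finally have "z k 0 \<in> hypercube 0 ((L 0 + \<beta> 0 / (1 - q)) / real N)" by (simp add: hypercube_def)
      then show ?thesis by (rule norm_hypercube_zero_le)
    qed
    then show ?thesis by blast
  qed
  then obtain m where m: "\<And>k. norm (z k 0) \<le> m" by blast

  have "infnorm (quantization_error A T xh Pd t) \<le> (m + \<gamma> * T) * exp (a * T)" if "0 \<le> t" for t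
  proof -
    let ?k = "interval_index T t"
    have "quantization_error A T xh Pd t = z ?k (t - real ?k * T)"
      by (simp add: quantization_error_def decoder_output_def z_def)
    moreover have "norm (z ?k (t - real ?k * T)) \<le> (norm (z ?k 0) + \<gamma> * T) * exp (a * T)"
      using interval_index_bounds[OF T_pos that] g by (intro grow)
    moreover have "\<dots> \<le> (m + \<gamma> * T) * exp (a * T)" using m[of ?k] by (intro mult_right_mono) auto
    ultimately show ?thesis by (metis infnorm_le_norm order_trans)
  qed
  moreover have "\<exists>M. \<forall>t\<ge>0. infnorm (held_quantization_error T xh Pd t) \<le> M"
    if bdd: "bounded (x ` {0..})"
  proof -
    obtain bx where bx: "\<And>t. 0 \<le> t \<Longrightarrow> norm (x t) \<le> bx"
      using bdd unfolding bounded_iff by auto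
    have bxh: "norm (xh t) \<le> bx + be" if "0 \<le> t" for t
      using norm_triangle_ineq[of "x t" "e t"] bx[OF that] be[OF that] by (simp add: e_def)
    have "infnorm (held_quantization_error T xh Pd t) \<le> 2 * (bx + be) + m" if "0 \<le> t" for t
    proof -
      let ?k = "interval_index T t"
      have "held_quantization_error T xh Pd t = xh t - xh (real ?k * T) + z ?k 0"
        by (simp add: held_quantization_error_def z0)
      then have "norm (held_quantization_error T xh Pd t)
          \<le> norm (xh t) + norm (xh (real ?k * T)) + norm (z ?k 0)"
        by (metis add_right_mono norm_triangle_ineq4 norm_triangle_le)
      also have "\<dots> \<le> 2 * (bx + be) + m"
        using bxh[OF that] bxh[of "real ?k * T"] m[of ?k] T_pos by simp
      finally show ?thesis using infnorm_le_norm order_trans by blast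
    qed
    then show ?thesis by blast
  qed
  ultimately show ?thesis by blast
qed

end
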